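(* Consider 8-move peg solitaire on the 37-hole board. Then: (1) The central game (start with every hole occupied except the center $d4$, finish with a single peg at $d4$) cannot be solved in fewer than 13 moves. (2) No single vacancy to single survivor problem (start with every hole occupied except one hole, finish with exactly one peg anywhere) can be solved in fewer than 12 moves. (3) The $C9$-complement problem (start with every hole occupied except the nine central holes $c3,d3,e3,c4,d4,e4,c5,d5,e5$, finish with exactly those nine central holes occupied and all others empty) cannot be solved in fewer than 13 moves, and in any 13-move solution every move starts at a hole outside these nine central holes and ends at a hole inside them.
   Context: The 37-hole board has columns labeled a–g (left to right) and rows 1–7 (top to bottom); rows 1 and 7 contain holes in columns c,d,e; rows 2 and 6 contain columns b–f; rows 3,4,5 contain columns a–g. Each hole is empty or holds one peg. In 8-move solitaire a jump takes a peg at hole $p$, with hole $p+v$ occupied and $p+2v$ empty, where $v$ is one of the 8 horizontal, vertical or diagonal unit steps and all three holes lie on the board; the peg moves to $p+2v$ and the peg at $p+v$ is removed. A move is a maximal sequence of one or more consecutive jumps made by the same peg; the length of a solution is its number of moves. *)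

theory Defs
  imports Main "HOL-Library.Product_Plus"
begin

text \<open>A hole is a pair (column, row): columns a--g are numbered 1--7 from left to right,
  rows are numbered 1--7 from top to bottom.  So d4 is \<open>(4, 4)\<close>.\<close>

type_synonym hole = "int \<times> int"

definition board :: "hole set" where
  "board = {3..5} \<times> {1, 7} \<union> {2..6} \<times> {2, 6} \<union> {1..7} \<times> {3, 4, 5}"

definition center :: hole where
  "center = (4, 4)"

definition C9 :: "hole set" where
  "C9 = {3..5} \<times> {3..5}"

definition unit_steps :: "(int \<times> int) set" where
  "unit_steps = {-1, 0, 1} \<times> {-1, 0, 1} - {(0, 0)}"

text \<open>A jump is a pair \<open>(p, v)\<close> of the hole of the jumping peg and its direction.
  A position is the set of occupied holes.\<close>

type_synonym jump = "hole \<times> (int \<times> int)"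

fun jump_start :: "jump \<Rightarrow> hole" where
  "jump_start (p, v) = p"

fun jump_end :: "jump \<Rightarrow> hole" where
  "jump_end (p, v) = p + v + v"

fun legal_jump :: "hole set \<Rightarrow> jump \<Rightarrow> bool" where
  "legal_jump S (p, v) \<longleftrightarrow>
     v \<in> unit_steps \<and> {p, p + v, p + v + v} \<subseteq> board \<and>
     p \<in> S \<and> p + v \<in> S \<and> p + v + v \<notin> S"

fun do_jump :: "hole set \<Rightarrow> jump \<Rightarrow> hole set" where
  "do_jump S (p, v) = insert (p + v + v) (S - {p, p + v})"

fun plays :: "hole set \<Rightarrow> jump list \<Rightarrow> hole set \<Rightarrow> bool" where
  "plays S [] T \<longleftrightarrow> S = T"
| "plays S (j # js) T \<longleftrightarrow> legal_jump S j \<and> plays (do_jump S j) js T"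

text \<open>Two consecutive jumps in a play are made by the same peg iff the second one starts in the
  hole where the first one ended, because a hole holds at most one peg.\<close>

definition same_peg :: "jump \<Rightarrow> jump \<Rightarrow> bool" where
  "same_peg j k \<longleftrightarrow> jump_end j = jump_start k"

text \<open>A solution is given as its list of moves, each of which is its list of jumps.  The second
  \<open>successively\<close> condition is maximality: no move can be prolonged by the first jump of the
  next one.  Every play decomposes uniquely in this way.\<close>

definition solution :: "hole set \<Rightarrow> hole set \<Rightarrow> jump list list \<Rightarrow> bool" where
  "solution S T ms \<longleftrightarrow>
     plays S (concat ms) T \<and>
     (\<forall>m \<in> set ms. m \<noteq> [] \<and> successively same_peg m) \<and>
     successively (\<lambda>m n. \<not> same_peg (last m) (hd n)) ms"

definition move_start :: "jump list \<Rightarrow> hole" where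
  "move_start m = jump_start (hd m)"

definition move_end :: "jump list \<Rightarrow> hole" where
  "move_end m = jump_end (last m)"

end

theory Submission
  imports Defs
begin

text \<open>A jump preserves the parity class of the jumping peg and captures a peg of another class.
  Of the 12 holes with both coordinates odd, the 8 corners can never be jumped over, so each corner
  requires a move that starts there, and odd pegs are captured only on the 4 inner odd holes.  Hence
  a move captures at most 4 odd pegs, and it captures none unless its own peg is not odd.  A single
  survivor problem has 10 to 12 odd pegs to capture, and it needs 8 moves from corners in addition.
  The opening is inefficient: a move whose class has a single vacancy is a single jump, which
  accounts for the remaining moves of the bound.  In the C9-complement problem, 8 odd pegs have to
  leave the corners and 5 other holes of C9 have to be filled, each by the end of a move of a peg
  that is not odd.\<close>

section \<open>The effect of a single move\<close>

definition parity :: "hole \<Rightarrow> bool \<times> bool" where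
  "parity p = (even (fst p), even (snd p))"

fun jump_mid :: "jump \<Rightarrow> hole" where
  "jump_mid (p, v) = p + v"

definition captured :: "jump list \<Rightarrow> hole set" where
  "captured m = jump_mid ` set m"

definition is_move :: "hole set \<Rightarrow> jump list \<Rightarrow> hole set \<Rightarrow> bool" where
  "is_move S m T \<longleftrightarrow> m \<noteq> [] \<and> successively same_peg m \<and> plays S m T"

lemma parity_jump:
  assumes "v \<in> unit_steps"
  shows "parity (p + v) \<noteq> parity p" "parity (p + v + v) = parity p"
  using assms by (cases p; auto simp: parity_def unit_steps_def)+

lemma is_move_Cons:
  assumes "is_move S ((p, v) # m) T" "m \<noteq> []"
  shows "is_move (do_jump S (p, v)) m T" "move_start m = p + v + v"
  using assms by (cases m; auto simp: is_move_def same_peg_def move_start_def)+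

lemma is_move_legal_first:
  assumes "is_move S (j # m) T"
  shows "legal_jump S j"
  using assms by (simp add: is_move_def)

lemma move_start_Cons [simp]: "move_start ((p, v) # m) = p"
  by (simp add: move_start_def)

lemma move_end_Cons: "m \<noteq> [] \<Longrightarrow> move_end (j # m) = move_end m"
  by (simp add: move_end_def)

text \<open>One induction carries all the facts, since they support each other: a captured hole is
  of another class than the moving peg, so it stays empty for the rest of the move and cannot be
  captured again. The peg may return to its own start, which is why the start is removed from
  \<open>S\<close> in the claim about \<open>move_end m\<close>.\<close>

lemma is_move_effect:
  assumes "is_move S m T"
  shows "move_start m \<in> S \<inter> board" "move_end m \<in> board" "move_end m \<notin> S - {move_start m}"
    "captured m \<subseteq> S \<inter> board" "parity (move_end m) = parity (move_start m)"
    "parity (move_start m) \<notin> parity ` captured m" "distinct (map jump_mid m)"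
    "T = insert (move_end m) (S - {move_start m} - captured m)"
proof -
  have "move_start m \<in> S \<inter> board \<and> move_end m \<in> board \<and> move_end m \<notin> S - {move_start m} \<and>
    captured m \<subseteq> S \<inter> board \<and> parity (move_end m) = parity (move_start m) \<and>
    parity (move_start m) \<notin> parity ` captured m \<and> distinct (map jump_mid m) \<and>
    T = insert (move_end m) (S - {move_start m} - captured m)"
    using assms
  proof (induction m arbitrary: S)
    case Nil
    then show ?case by (simp add: is_move_def)
  next
    case (Cons j m)
    obtain p v where j: "j = (p, v)" by (cases j)
    have legal: "legal_jump S (p, v)" using is_move_legal_first Cons.prems j by blast
    then have v: "v \<in> unit_steps" by simp
    note par = parity_jump[OF v, of p]
    show ?case
    proof (cases "m = []")
      case True
      with Cons.prems legal par show ?thesis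
        by (auto simp: j is_move_def move_end_def captured_def)
    next
      case False
      have m: "is_move (do_jump S (p, v)) m T" and st: "move_start m = p + v + v"
        using is_move_Cons[of S p v m T] Cons.prems False j by auto
      note IH = Cons.IH[OF m, unfolded st]
      \<comment> \<open>The landing hole \<open>p + v + v\<close> is occupied after the jump, but
        its parity keeps it out of the later captures.\<close>
      have sub: "captured m \<subseteq> S - {p, p + v}"
        using IH by auto
      have "p + v \<notin> captured m"
        using sub by auto
      then have "distinct (map jump_mid (j # m))"
        using IH by (auto simp: j captured_def)
      moreover have "captured (j # m) = insert (p + v) (captured m)"
        by (simp add: captured_def j)
      ultimately show ?thesis
        using IH legal par sub False
        by (auto simp: j move_end_Cons)
    qed
  qed
  then show "move_start m \<in> S \<inter> board" "move_end m \<in> board" "move_end m \<notin> S - {move_start m}"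
    "captured m \<subseteq> S \<inter> board" "parity (move_end m) = parity (move_start m)"
    "parity (move_start m) \<notin> parity ` captured m" "distinct (map jump_mid m)"
    "T = insert (move_end m) (S - {move_start m} - captured m)"
    by blast+
qed

text \<open>Together with \<open>a\<close> itself these are the only holes that a peg starting at
  \<open>a\<close> can visit in one move.\<close>

definition vacant :: "hole set \<Rightarrow> hole \<Rightarrow> hole set" where
  "vacant S a = {h \<in> board - S. parity h = parity a}"

text \<open>A captured hole is the midpoint of two consecutive holes visited by the peg, and
  \<open>x + y = c + c\<close> expresses this without division. The set of holes open to the peg
  does not grow during the move, because captures empty holes of other classes only.\<close>

lemma captured_between:
  assumes "is_move S m T" "c \<in> captured m"
  shows "\<exists>x \<in> insert (move_start m) (vacant S (move_start m)).
         \<exists>y \<in> insert (move_start m) (vacant S (move_start m)). x \<noteq> y \<and> x + y = c + c"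
  using assms
proof (induction m arbitrary: S)
  case Nil
  then show ?case by (simp add: captured_def)
next
  case (Cons j m)
  obtain p v where j: "j = (p, v)" by (cases j)
  have legal: "legal_jump S (p, v)" using is_move_legal_first Cons.prems j by blast
  then have v: "v \<in> unit_steps" by simp
  note par = parity_jump[OF v, of p]
  show ?case
  proof (cases "c = p + v")
    case True
    have "p \<noteq> p + v + v"
    proof -
      obtain a b where "v = (a, b)" by (cases v)
      moreover have "a \<noteq> 0 \<or> b \<noteq> 0"
        using v by (auto simp: \<open>v = (a, b)\<close> unit_steps_def)
      ultimately show ?thesis by (cases p) auto
    qed
    moreover have "p + (p + v + v) = c + c"
      using True by (simp add: algebra_simps)
    moreover have "p + v + v \<in> vacant S p"
      using legal par by (simp add: vacant_def)
    ultimately show ?thesis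
      unfolding j move_start_Cons by blast
  next
    case False
    then have c: "c \<in> captured m" using Cons.prems by (simp add: captured_def j)
    then have ne: "m \<noteq> []" by (auto simp: captured_def)
    have m: "is_move (do_jump S (p, v)) m T" and st: "move_start m = p + v + v"
      using is_move_Cons[of S p v m T] Cons.prems ne j by auto
    \<comment> \<open>The only new vacancy in the class is \<open>p\<close>; the captured hole
      \<open>p + v\<close> has another parity.\<close>
    have "insert (p + v + v) (vacant (do_jump S (p, v)) (p + v + v)) \<subseteq> insert p (vacant S p)"
      using legal par by (auto simp: vacant_def)
    then show ?thesis
      using Cons.IH[OF m c] unfolding st j move_start_Cons by (meson subsetD)
  qed
qed

lemma double_hole_inj: "c + c = d + d \<Longrightarrow> c = d" for c d :: hole
  by (cases c; cases d) auto

lemma move_end_vacant: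
  assumes "is_move S m T"
  shows "move_end m \<in> insert (move_start m) (vacant S (move_start m))"
  using is_move_effect[OF assms] by (auto simp: vacant_def)

text \<open>The peg can only go between its start and \<open>u\<close>. These have one midpoint, and
  the peg there can be captured only once, so the move is a single jump.\<close>

lemma move_one_vacancy:
  assumes m: "is_move S m T" and v: "vacant S (move_start m) \<subseteq> {u}"
  obtains c where "captured m = {c}" "move_end m = u"
proof -
  have "c = d" if "c \<in> captured m" "d \<in> captured m" for c d
  proof -
    have "c + c = move_start m + u" "d + d = move_start m + u"
      using captured_between[OF m that(1)] captured_between[OF m that(2)] v
      by (auto simp: add.commute)
    then show ?thesis using double_hole_inj by metis
  qed
  moreover obtain j m' where jm: "m = j # m'"
    using m by (cases m) (auto simp: is_move_def)
  moreover have "jump_mid j \<in> captured m"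
    by (simp add: jm captured_def)
  ultimately have c: "captured m = {jump_mid j}"
    by blast
  have "distinct (map jump_mid m)"
    using is_move_effect(7)[OF m] .
  then have "m' = []"
    using c by (cases m') (auto simp: jm captured_def)
  then have "move_end m \<noteq> move_start m"
    using m by (cases j; cases "fst j") (auto simp: jm is_move_def move_end_def unit_steps_def)
  then show ?thesis
    using move_end_vacant[OF m] v c that by auto
qed

section \<open>Counting over a sequence of moves\<close>

fun is_moves :: "hole set \<Rightarrow> jump list list \<Rightarrow> hole set \<Rightarrow> bool" where
  "is_moves S [] T \<longleftrightarrow> S = T"
| "is_moves S (m # ms) T \<longleftrightarrow> (\<exists>U. is_move S m U \<and> is_moves U ms T)"

lemma plays_append: "plays S (xs @ ys) T \<longleftrightarrow> (\<exists>U. plays S xs U \<and> plays U ys T)"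
  by (induction xs arbitrary: S) auto

lemma solution_is_moves:
  assumes "solution S T ms"
  shows "is_moves S ms T"
proof -
  have "plays S (concat ms) T" "\<forall>m\<in>set ms. m \<noteq> [] \<and> successively same_peg m"
    using assms by (auto simp: solution_def)
  then show ?thesis
    by (induction ms arbitrary: S) (auto simp: plays_append is_move_def)
qed

lemma is_moves_append: "is_moves S (xs @ ys) T \<longleftrightarrow> (\<exists>U. is_moves S xs U \<and> is_moves U ys T)"
  by (induction xs arbitrary: S) auto

lemma is_moves_memE:
  assumes "is_moves S ms T" "m \<in> set ms"
  obtains U V where "is_move U m V"
  using assms by (metis is_moves.simps(2) is_moves_append split_list)

definition starts :: "hole set \<Rightarrow> jump list list \<Rightarrow> nat" where
  "starts A ms = length (filter (\<lambda>m. move_start m \<in> A) ms)"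

definition ends :: "hole set \<Rightarrow> jump list list \<Rightarrow> nat" where
  "ends A ms = length (filter (\<lambda>m. move_end m \<in> A) ms)"

definition caps :: "hole set \<Rightarrow> jump list list \<Rightarrow> nat" where
  "caps A ms = (\<Sum>m\<leftarrow>ms. card (A \<inter> captured m))"

text \<open>\<open>S\<close> splits into the untouched pegs \<open>B\<close>, the moving peg and the
  captured pegs. Losses stand on the left and gains on the right, so that no subtraction of naturals
  occurs.\<close>

lemma card_move:
  assumes m: "is_move S m T" and A: "finite A"
  shows "card (A \<inter> T) + of_bool (move_start m \<in> A) + card (A \<inter> captured m) =
         card (A \<inter> S) + of_bool (move_end m \<in> A)"
proof -
  note e = is_move_effect[OF m]
  define B where "B = S - {move_start m} - captured m"
  have "move_start m \<notin> captured m" using e(6) by auto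
  then have "A \<inter> S = (A \<inter> B) \<union> ((A \<inter> {move_start m}) \<union> (A \<inter> captured m))"
    using e(1,4) by (auto simp: B_def)
  moreover have "card \<dots> = card (A \<inter> B) + card ((A \<inter> {move_start m}) \<union> (A \<inter> captured m))"
    using A by (intro card_Un_disjoint) (auto simp: B_def)
  moreover have "card ((A \<inter> {move_start m}) \<union> (A \<inter> captured m)) =
      card (A \<inter> {move_start m}) + card (A \<inter> captured m)"
    using A \<open>move_start m \<notin> captured m\<close> by (intro card_Un_disjoint) auto
  moreover have "card (A \<inter> {h}) = of_bool (h \<in> A)" for h
    by (cases "h \<in> A") auto
  moreover have "card (A \<inter> T) = card (A \<inter> B) + of_bool (move_end m \<in> A)"
  proof -
    have "move_end m \<notin> B" using e(3) by (auto simp: B_def)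
    then show ?thesis
      using A e(8) by (cases "move_end m \<in> A") (auto simp: B_def[symmetric])
  qed
  ultimately show ?thesis by simp
qed

lemma card_moves:
  assumes "is_moves S ms T" "finite A"
  shows "card (A \<inter> T) + starts A ms + caps A ms = card (A \<inter> S) + ends A ms"
  using assms
proof (induction ms arbitrary: S)
  case Nil
  then show ?case by (simp add: starts_def ends_def caps_def)
next
  case (Cons m ms)
  then obtain U where "is_move S m U" "is_moves U ms T" by auto
  then show ?case
    using card_move[of S m U A] Cons.IH[of U] Cons.prems
    by (auto simp: starts_def ends_def caps_def)
qed

section \<open>Holes with both coordinates odd\<close>

definition inner :: "hole set" where
  "inner = {3, 5} \<times> {3, 5}"

text \<open>The board is an octagon, and these are its vertices; \<open>inner\<close> holds the odd
  holes of \<open>C9\<close>.\<close>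

definition corners :: "hole set" where
  "corners = {3, 5} \<times> {1, 7} \<union> {1, 7} \<times> {3, 5}"

abbreviation odds :: "hole set" where
  "odds \<equiv> corners \<union> inner"

lemma finite_inner [simp]: "finite inner" and card_inner: "card inner = 4"
  by (simp_all add: inner_def card_cartesian_product)

lemma corners_eq: "corners = {(3,1),(3,7),(5,1),(5,7),(1,3),(1,5),(7,3),(7,5)}"
  by (auto simp: corners_def)

lemma finite_corners [simp]: "finite corners" and card_corners: "card corners = 8"
  by (simp_all add: corners_eq)

lemma corners_inner: "corners \<inter> inner = {}"
  by (auto simp: corners_def inner_def)

lemma card_odds: "card odds = 12"
  by (simp add: card_Un_disjoint corners_inner card_corners card_inner)

lemma odds_board: "odds \<subseteq> board"
  by (auto simp: corners_def inner_def board_def)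

text \<open>Of the 16 pairs with entries in {1,3,5,7}, only (1,1), (1,7), (7,1) and (7,7) are off
  the board, so \<open>odds\<close> is a full parity class.\<close>

lemma odds_iff:
  assumes "h \<in> board"
  shows "h \<in> odds \<longleftrightarrow> parity h = (False, False)"
proof -
  obtain x y where h: "h = (x, y)" by (cases h)
  show ?thesis
  proof
    show "parity h = (False, False)" if "h \<in> odds"
      using that by (auto simp: h parity_def corners_def inner_def)
    show "h \<in> odds" if "parity h = (False, False)"
    proof -
      have "odd x" "odd y" using that by (auto simp: h parity_def)
      moreover have "x \<in> {1..7}" "y \<in> {1..7}"
        using assms by (auto simp: h board_def)
      ultimately have "x = 1 \<or> x = 3 \<or> x = 5 \<or> x = 7" "y = 1 \<or> y = 3 \<or> y = 5 \<or> y = 7"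
        unfolding atLeastAtMost_iff by presburger+
      then show ?thesis
        using assms unfolding h by (elim disjE) (simp_all add: board_def corners_def inner_def)
    qed
  qed
qed

lemma unit_steps_eq: "unit_steps = {(-1,-1),(-1,0),(-1,1),(0,-1),(0,1),(1,-1),(1,0),(1,1)}"
  by (auto simp: unit_steps_def)

text \<open>A vertex of the convex hull of the board is not the midpoint of two other holes.\<close>

lemma corner_extreme:
  "\<forall>h\<in>corners. \<forall>v\<in>unit_steps. \<not> (h - v \<in> board \<and> h + v \<in> board)"
  by (simp add: corners_eq unit_steps_eq board_def)

lemma corner_not_captured:
  assumes "is_move S m T"
  shows "captured m \<inter> corners = {}"
proof -
  have "jump_mid j \<notin> corners" if "legal_jump U j" for U j
  proof
    obtain p v where j: "j = (p, v)" by (cases j)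
    assume "jump_mid j \<in> corners"
    moreover have "p + v - v = p" by simp
    ultimately show False
      using that corner_extreme by (metis j insert_subset jump_mid.simps legal_jump.simps)
  qed
  moreover have "\<exists>U. legal_jump U j" if "plays S m T" "j \<in> set m" for j
    using that by (induction m arbitrary: S) auto
  ultimately have "jump_mid j \<notin> corners" if "j \<in> set m" for j
    using assms that unfolding is_move_def by blast
  then show ?thesis by (auto simp: captured_def)
qed

lemma move_odds:
  assumes "is_move S m T"
  shows "move_end m \<in> odds \<longleftrightarrow> move_start m \<in> odds"
    "move_start m \<in> odds \<Longrightarrow> odds \<inter> captured m = {}"
    "card (odds \<inter> captured m) \<le> 4"
proof -
  note e = is_move_effect[OF assms]
  show "move_end m \<in> odds \<longleftrightarrow> move_start m \<in> odds"
    using e odds_iff by auto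
  show "odds \<inter> captured m = {}" if "move_start m \<in> odds"
  proof -
    have "parity (move_start m) = (False, False)" using that e odds_iff by auto
    then have "c \<notin> odds" if "c \<in> captured m" for c
      using that e(4,6) odds_iff[of c] by (metis IntD2 image_eqI subsetD)
    then show ?thesis by blast
  qed
  have "odds \<inter> captured m \<subseteq> inner" using corner_not_captured[OF assms] by auto
  then show "card (odds \<inter> captured m) \<le> 4"
    using card_mono[OF finite_inner] card_inner by metis
qed

text \<open>No capture term appears, so a corner peg can leave only by a move of its own. This is
  the source of the 8 moves in every bound.\<close>

lemma card_corners_moves:
  assumes "is_moves S ms T"
  shows "card (corners \<inter> T) + starts corners ms = card (corners \<inter> S) + ends corners ms"
proof -
  have "corners \<inter> captured m = {}" if m: "m \<in> set ms" for m
  proof -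
    obtain U V where "is_move U m V" using is_moves_memE[OF assms m] .
    from corner_not_captured[OF this] show ?thesis by blast
  qed
  then have "caps corners ms = 0"
    by (simp add: caps_def)
  then show ?thesis using card_moves[OF assms finite_corners] by simp
qed

text \<open>Each move stays inside or outside the odd class, so starts and ends in it cancel and
  only captures change its number of pegs.\<close>

lemma caps_odds:
  assumes "is_moves S ms T"
  shows "card (odds \<inter> T) + caps odds ms = card (odds \<inter> S)"
proof -
  have "move_start m \<in> odds \<longleftrightarrow> move_end m \<in> odds" if m: "m \<in> set ms" for m
  proof -
    obtain U V where "is_move U m V" using is_moves_memE[OF assms m] .
    from move_odds(1)[OF this] show ?thesis by (rule sym)
  qed
  then have "filter (\<lambda>m. move_start m \<in> odds) ms = filter (\<lambda>m. move_end m \<in> odds) ms"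
    by (rule filter_cong[OF refl])
  then have "starts odds ms = ends odds ms" by (simp add: starts_def ends_def)
  then show ?thesis using card_moves[OF assms, of odds] by simp
qed

lemma caps_odds_le:
  assumes "is_moves S ms T"
  shows "caps odds ms \<le> 4 * starts (- odds) ms"
  using assms
proof (induction ms arbitrary: S)
  case Nil
  then show ?case by (simp add: caps_def)
next
  case (Cons m ms)
  then obtain U where "is_move S m U" "is_moves U ms T" by auto
  with Cons.IH[of U] move_odds(2,3)[of S m U] show ?case
    by (cases "move_start m \<in> odds") (auto simp: caps_def starts_def)
qed

lemma length_starts: "length ms = starts A ms + starts (- A) ms"
  unfolding starts_def using sum_length_filter_compl[of "\<lambda>m. move_start m \<in> A" ms] by simp

lemma starts_mono: "A \<subseteq> B \<Longrightarrow> starts A ms \<le> starts B ms"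
  and ends_mono: "A \<subseteq> B \<Longrightarrow> ends A ms \<le> ends B ms"
  unfolding starts_def ends_def by (induction ms) auto

section \<open>Single vacancy to single survivor\<close>

lemma caps_Cons: "caps A (m # ms) = card (A \<inter> captured m) + caps A ms"
  and starts_Cons: "starts A (m # ms) = of_bool (move_start m \<in> A) + starts A ms"
  by (simp_all add: caps_def starts_def)

lemma card_remove_of_bool: "finite A \<Longrightarrow> card (A - {h}) = card A - of_bool (h \<in> A)"
  by (cases "h \<in> A") auto

text \<open>The board has a single vacancy, hence so has at most each class, and the opening is one
  jump into \<open>s\<close>.\<close>

lemma first_move:
  assumes m: "is_move (board - {s}) m T" and s: "s \<in> board"
  obtains c where "captured m = {c}" "move_end m = s" "parity (move_start m) = parity s"
    "parity c \<noteq> parity s" "T = board - {move_start m, c}"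
proof -
  have "vacant (board - {s}) (move_start m) \<subseteq> {s}"
    by (auto simp: vacant_def)
  then obtain c where c: "captured m = {c}" "move_end m = s"
    using move_one_vacancy[OF m] by metis
  note e = is_move_effect[OF m]
  have "parity (move_start m) = parity s" "parity c \<noteq> parity s"
    using c e(5,6) by auto
  moreover have "T = board - {move_start m, c}"
    using c s e(1,4,8) by auto
  ultimately show ?thesis using that c by blast
qed

lemma last_move_end:
  assumes "is_moves S (ms @ [m]) {t}"
  shows "move_end m = t"
proof -
  obtain U where "is_move U m {t}" using assms by (auto simp: is_moves_append)
  then show ?thesis using is_move_effect(8) by blast
qed

text \<open>This is the equality case of \<open>starts_mono\<close>. When a count of moves leaves no
  slack, it forces every odd start to be a corner.\<close>

lemma starts_all_imp:
  assumes "starts A ms = starts B ms" "A \<subseteq> B" "m \<in> set ms" "move_start m \<in> B"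
  shows "move_start m \<in> A"
proof (rule ccontr)
  assume "move_start m \<notin> A"
  moreover obtain xs ys where "ms = xs @ m # ys" using assms(3) by (meson split_list)
  ultimately show False
    using assms(1,4) starts_mono[OF assms(2), of xs] starts_mono[OF assms(2), of ys]
    by (simp add: starts_def)
qed

lemma ends_all_imp:
  assumes "ends A ms = ends B ms" "A \<subseteq> B" "m \<in> set ms" "move_end m \<in> B"
  shows "move_end m \<in> A"
proof (rule ccontr)
  assume "move_end m \<notin> A"
  moreover obtain xs ys where "ms = xs @ m # ys" using assms(3) by (meson split_list)
  ultimately show False
    using assms(1,4) ends_mono[OF assms(2), of xs] ends_mono[OF assms(2), of ys]
    by (simp add: ends_def)
qed

lemma ends_0: "ends A ms = 0 \<Longrightarrow> m \<in> set ms \<Longrightarrow> move_end m \<notin> A"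
  by (auto simp: ends_def filter_empty_conv)

lemma card_Int_singleton_le: "card (A \<inter> {c}) \<le> 1"
  using card_mono[of "{c}" "A \<inter> {c}"] by simp

text \<open>The first move ends at \<open>s\<close> and the last at \<open>t\<close>. Splitting both
  off cancels the corrections for \<open>s\<close> or \<open>t\<close> being a corner, which leaves
  exactly 8 plus the corner ends of the middle moves.\<close>

lemma single_survivor_structure:
  assumes ms: "is_moves (board - {s}) ms {t}" and s: "s \<in> board" and t: "t \<in> board"
  obtains m mid l T where "ms = m # mid @ [l]" "is_move (board - {s}) m T" "is_moves T (mid @ [l]) {t}"
    "starts corners ms = 8 + ends corners mid"
    "caps odds ms + of_bool (s \<in> odds) + of_bool (t \<in> odds) = 12"
proof -
  have caps: "caps odds ms + of_bool (s \<in> odds) + of_bool (t \<in> odds) = 12"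
  proof -
    have "odds \<inter> (board - {s}) = odds - {s}" using odds_board by auto
    moreover have "card (odds \<inter> {t}) = of_bool (t \<in> odds)"
      by (cases "t \<in> odds") auto
    ultimately show ?thesis
      using caps_odds[OF ms] card_remove_of_bool[of odds s] card_odds
      by (cases "s \<in> odds") auto
  qed
  then have "ms \<noteq> []" by (auto simp: caps_def of_bool_def split: if_splits)
  then obtain m ms' where ms': "ms = m # ms'" by (cases ms) auto
  then obtain T where m: "is_move (board - {s}) m T" and T: "is_moves T ms' {t}"
    using ms by auto
  obtain c where c: "captured m = {c}" "move_end m = s"
    using first_move[OF m s] by metis
  have "ms' \<noteq> []"
  proof
    assume "ms' = []"
    then have "caps odds ms \<le> 1"
      using c card_Int_singleton_le[of odds c] by (simp add: ms' caps_def)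
    then show False using caps by (auto simp: of_bool_def split: if_splits)
  qed
  then obtain mid l where l: "ms' = mid @ [l]" by (cases ms' rule: rev_cases) auto
  have "move_end l = t" using last_move_end T l by blast
  then have "ends corners ms = of_bool (s \<in> corners) + ends corners mid + of_bool (t \<in> corners)"
    using c by (simp add: ms' l ends_def)
  moreover have "card (corners \<inter> (board - {s})) = 8 - of_bool (s \<in> corners)"
  proof -
    have "corners \<inter> (board - {s}) = corners - {s}" using odds_board by auto
    then show ?thesis using card_remove_of_bool[of corners s] card_corners by simp
  qed
  moreover have "card (corners \<inter> {t}) = of_bool (t \<in> corners)"
    by (cases "t \<in> corners") auto
  ultimately have "starts corners ms = 8 + ends corners mid"
    using card_corners_moves[OF ms] by (cases "s \<in> corners") auto
  then show ?thesis using that caps ms' l m T by blast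
qed

text \<open>If \<open>s\<close> is not odd, the opening wastes one of the moves able to capture odd
  pegs. If \<open>s\<close> is odd, the opening captures no odd peg, and for fewer than 12 moves the
  waste is found in the second move.\<close>

theorem single_vacancy_bound:
  assumes ms: "is_moves (board - {s}) ms {t}" and s: "s \<in> board" and t: "t \<in> board"
  shows "12 \<le> length ms"
proof -
  obtain m mid l T where ms_eq: "ms = m # mid @ [l]" and m: "is_move (board - {s}) m T"
    and T: "is_moves T (mid @ [l]) {t}" and st: "starts corners ms = 8 + ends corners mid"
    and caps: "caps odds ms + of_bool (s \<in> odds) + of_bool (t \<in> odds) = 12"
    using single_survivor_structure[OF assms] .
  obtain c where c: "captured m = {c}" "move_end m = s" "parity (move_start m) = parity s"
    "parity c \<noteq> parity s" "T = board - {move_start m, c}"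
    using first_move[OF m s] .
  have m_odds: "move_start m \<in> odds \<longleftrightarrow> s \<in> odds" using move_odds(1)[OF m] c by simp
  note len = length_starts[of ms odds]
  have odds8: "starts odds ms \<ge> starts corners ms"
    by (intro starts_mono) auto
  note rest = caps_odds_le[OF T]
  show ?thesis
  proof (cases "s \<in> odds")
    case False
    \<comment> \<open>From 12, at most one is lost to \<open>t\<close> and at most one to the first
      move. The remaining 10 captures need three more moves from outside
      \<open>odds\<close>.\<close>
    have "caps odds (mid @ [l]) \<ge> 10"
      using caps False card_Int_singleton_le[of odds c]
      by (auto simp: ms_eq caps_Cons c(1) of_bool_def split: if_splits)
    then have "starts (- odds) ms \<ge> 4"
      using rest m_odds False by (simp add: ms_eq starts_Cons)
    then show ?thesis using len odds8 st by linarith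
  next
    case True
    show ?thesis
    proof (rule ccontr)
      assume "\<not> ?thesis"
      then have le: "length ms \<le> 11" by simp
      have "caps odds ms \<ge> 10"
        using caps by (auto simp: of_bool_def split: if_splits)
      then have "starts (- odds) ms \<ge> 3"
        using caps_odds_le[OF ms] by linarith
      \<comment> \<open>With at least 8 + 3 moves, eleven leave no slack: every odd move starts at a
        corner, and no middle move ends at one.\<close>
      then have n: "starts (- odds) ms = 3" "starts corners ms = starts odds ms"
          "ends corners mid = 0" "length ms = 11"
        using le len odds8 st by linarith+
      obtain m2 mid' where mid: "mid = m2 # mid'"
        using n(4) by (cases mid) (auto simp: ms_eq)
      obtain U where m2: "is_move T m2 U" and U: "is_moves U (mid' @ [l]) {t}"
        using T by (auto simp: mid)
      have "move_end m2 \<notin> corners" using ends_0[OF n(3)] by (simp add: mid)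
      have "c \<notin> odds"
        using True c(3,4) s is_move_effect(4)[OF m] odds_iff c(1) by auto
      have m2_odds: "move_start m2 \<notin> odds"
      proof
        assume a: "move_start m2 \<in> odds"
        have "move_start m2 \<in> corners" "move_start m \<in> corners"
          using starts_all_imp[OF n(2)] a m_odds True by (auto simp: ms_eq mid)
        \<comment> \<open>The other candidates, the starts of the first two moves, are corners and
          so excluded as ends.\<close>
        then have "move_end m2 \<in> {c}"
          using move_end_vacant[OF m2] \<open>move_end m2 \<notin> corners\<close> by (auto simp: vacant_def c(5))
        then show False using move_odds(1)[OF m2] a \<open>c \<notin> odds\<close> by auto
      qed
      have "parity (move_start m2) \<noteq> parity (move_start m)"
        using m2_odds True m_odds is_move_effect(1)[OF m] is_move_effect(1)[OF m2] odds_iff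
        by (metis IntD2)
      then have "vacant T (move_start m2) \<subseteq> {c}"
        by (auto simp: vacant_def c(5))
      then obtain d where d: "captured m2 = {d}" using move_one_vacancy[OF m2] by metis
      have "starts (- odds) (mid' @ [l]) = 2"
        using n(1) m2_odds m_odds True by (auto simp: ms_eq mid starts_Cons)
      then have "caps odds (mid' @ [l]) \<le> 8" using caps_odds_le[OF U] by simp
      moreover have "odds \<inter> {c} = {}" using \<open>c \<notin> odds\<close> by simp
      \<comment> \<open>The first three terms of the total are 0 for the opening, at most 1 for
        \<open>m2\<close>, and at most 8 for the remaining moves.\<close>
      ultimately have "caps odds ms \<le> 9"
        using card_Int_singleton_le[of odds d] by (simp add: ms_eq mid caps_Cons c(1) d)
      then show False using \<open>caps odds ms \<ge> 10\<close> by simp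
    qed
  qed
qed

section \<open>The central game\<close>

text \<open>Were three odd holes captured, they would be the midpoints of the three pairs of visited
  holes, whose pairwise sums would then all be 2 modulo 4; this is impossible for even entries.\<close>

lemma two_vacancies_caps:
  assumes m: "is_move S m T" and v: "vacant S (move_start m) \<subseteq> {u, w}" and u: "even (fst u)"
  shows "card (odds \<inter> captured m) \<le> 2"
proof (rule ccontr)
  assume "\<not> ?thesis"
  then have three: "card (odds \<inter> captured m) \<ge> 3" by simp
  let ?a = "move_start m" and ?C = "odds \<inter> captured m"
  have sum: "c + c \<in> {?a + u, ?a + w, u + w}" if c: "c \<in> captured m" for c
  proof -
    obtain x y where "x \<in> {?a, u, w}" "y \<in> {?a, u, w}" "x \<noteq> y" "x + y = c + c"
      using captured_between[OF m c] v by blast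
    moreover from this have "x + y \<in> {?a + u, ?a + w, u + w}"
      by (elim insertE emptyE) (simp_all add: add.commute)
    ultimately show ?thesis by simp
  qed
  then have sums: "(\<lambda>c. c + c) ` ?C \<subseteq> {?a + u, ?a + w, u + w}"
    by blast
  have "inj_on (\<lambda>c. c + c) ?C" by (auto intro: inj_onI double_hole_inj)
  then have "card ((\<lambda>c. c + c) ` ?C) \<ge> 3" using three by (simp add: card_image)
  moreover have "card {?a + u, ?a + w, u + w} \<le> 3"
    by (simp add: card_insert_if)
  \<comment> \<open>Three distinct doubles among at most three sums exhaust them, so each sum is
    twice an odd hole.\<close>
  ultimately have eq: "(\<lambda>c. c + c) ` ?C = {?a + u, ?a + w, u + w}"
    using sums by (intro card_seteq) auto
  then obtain c d e where "c \<in> odds" "d \<in> odds" "e \<in> odds"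
    "?a + u = c + c" "?a + w = d + d" "u + w = e + e"
    by (smt (verit) IntD1 imageE insertCI)
  moreover have "odd (fst h)" if "h \<in> odds" for h
    using that by (auto simp: corners_def inner_def)
  ultimately show False
  proof -
    assume h: "\<And>h. h \<in> odds \<Longrightarrow> odd (fst h)"
    have "fst ?a + fst u = 2 * fst c" "fst ?a + fst w = 2 * fst d" "fst u + fst w = 2 * fst e"
      using \<open>?a + u = c + c\<close> \<open>?a + w = d + d\<close> \<open>u + w = e + e\<close> by (metis fst_add mult_2)+
    moreover have "odd (fst c)" "odd (fst d)" "odd (fst e)"
      using h \<open>c \<in> odds\<close> \<open>d \<in> odds\<close> \<open>e \<in> odds\<close> by auto
    \<comment> \<open>First plus third minus second equation gives
      \<open>fst u = fst c + fst e - fst d\<close>, which is odd.\<close>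
    ultimately show False using u by presburger
  qed
qed

text \<open>All 12 odd pegs are captured and the opening takes at most one, so three further moves
  from outside \<open>odds\<close> are needed, and 12 moves leave no slack. The second and third
  moves are then followed in turn until the captures fall short.\<close>

theorem central_game_bound:
  assumes ms: "is_moves (board - {center}) ms {center}"
  shows "13 \<le> length ms"
proof (rule ccontr)
  assume "\<not> ?thesis"
  then have le: "length ms \<le> 12" by simp
  have center: "center \<in> board" "center \<notin> odds" "parity center = (True, True)"
    by (auto simp: center_def board_def corners_def inner_def parity_def)
  obtain m mid l T where ms_eq: "ms = m # mid @ [l]" and m: "is_move (board - {center}) m T"
    and T: "is_moves T (mid @ [l]) {center}" and st: "starts corners ms = 8 + ends corners mid"
    and "caps odds ms + of_bool (center \<in> odds) + of_bool (center \<in> odds) = 12"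
    using single_survivor_structure[OF ms center(1,1)] .
  then have caps: "caps odds ms = 12" using center by simp
  obtain c where c: "captured m = {c}" "move_end m = center"
    "parity (move_start m) = parity center" "parity c \<noteq> parity center"
    "T = board - {move_start m, c}"
    using first_move[OF m center(1)] .
  have m_odds: "move_start m \<in> - odds" using move_odds(1)[OF m] c center(2) by simp
  note len = length_starts[of ms odds]
  have odds8: "starts odds ms \<ge> starts corners ms"
    by (intro starts_mono) auto
  have "caps odds (mid @ [l]) \<ge> 11"
    using caps card_Int_singleton_le[of odds c] by (simp add: ms_eq caps_Cons c(1))
  then have "starts (- odds) (mid @ [l]) \<ge> 3"
    using caps_odds_le[OF T] by linarith
  moreover have "starts (- odds) ms = 1 + starts (- odds) (mid @ [l])"
    unfolding ms_eq starts_Cons[of _ m] using m_odds by simp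
  ultimately have n: "starts (- odds) (mid @ [l]) = 3" "starts corners ms = starts odds ms"
      "ends corners mid = 0" "length ms = 12"
    using le len odds8 st by linarith+
  \<comment> \<open>Without slack, an odd move in the middle can only bring a corner peg to an inner
    hole.\<close>
  have odds_move: "move_start k \<in> corners \<and> move_end k \<in> inner"
    if "k \<in> set mid" "move_start k \<in> odds" "is_move U k V" for U k V
    using that starts_all_imp[OF n(2), of k] ends_0[OF n(3)] move_odds(1)[OF that(3)]
    by (auto simp: ms_eq)
  obtain m2 m3 mid' where mid: "mid = m2 # m3 # mid'"
    using n(4) by (cases mid; cases "tl mid") (auto simp: ms_eq)
  obtain U V where m2: "is_move T m2 U" and m3: "is_move U m3 V"
    and U: "is_moves U (m3 # mid' @ [l]) {center}" and V: "is_moves V (mid' @ [l]) {center}"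
    using T by (auto simp: mid)
  note e2 = is_move_effect[OF m2] and e3 = is_move_effect[OF m3]
  have in_m2: "m2 \<in> set mid" and in_m3: "m3 \<in> set mid" by (simp_all add: mid)
  have start_m: "move_start m \<notin> odds" "even (fst (move_start m))"
    using m_odds c(3) center by (auto simp: parity_def)
  \<comment> \<open>After the opening each class has at most one vacancy, so a non-odd second move
    would capture one peg and the total would be at most 1 + 1 + 8.\<close>
  have m2_odds: "move_start m2 \<in> odds"
  proof (rule ccontr)
    assume a: "move_start m2 \<notin> odds"
    have "vacant T (move_start m2) \<subseteq> {move_start m} \<or> vacant T (move_start m2) \<subseteq> {c}"
      using c(3,4) by (cases "parity (move_start m2) = parity center") (auto simp: vacant_def c(5))
    then obtain d where d: "captured m2 = {d}" using move_one_vacancy[OF m2] by metis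
    have "starts (- odds) (m3 # mid' @ [l]) = 2"
      using n(1) a unfolding mid append_Cons starts_Cons[of _ m2] by simp
    then have "caps odds (m3 # mid' @ [l]) \<le> 8" using caps_odds_le[OF U] by simp
    then show False
      using caps card_Int_singleton_le[of odds c] card_Int_singleton_le[of odds d]
      unfolding ms_eq mid append_Cons caps_Cons[of _ m] caps_Cons[of _ m2] c(1) d by linarith
  qed
  have m2': "move_start m2 \<in> corners" "move_end m2 \<in> inner"
    using odds_move[OF in_m2 m2_odds m2] by auto
  \<comment> \<open>The second move needs an inner vacancy, and \<open>c\<close> is the only one
    that can serve; thus the opening captured an odd peg.\<close>
  have "move_end m2 = c"
    using move_end_vacant[OF m2] m2' corners_inner start_m(1) by (auto simp: vacant_def c(5))
  have "parity (move_start m2) \<noteq> parity (move_start m)"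
    using start_m(1) m2_odds is_move_effect(1)[OF m] e2(1) odds_iff by (metis IntD2)
  then have "vacant T (move_start m2) \<subseteq> {c}"
    by (auto simp: vacant_def c(5))
  then obtain d where d: "captured m2 = {d}" using move_one_vacancy[OF m2] by metis
  have d_odds: "d \<notin> odds" using move_odds(2)[OF m2 m2_odds] d by auto
  have U_eq: "U = board - {move_start m, move_start m2, d}"
  proof -
    have "c \<in> board" "c \<noteq> d" "c \<noteq> move_start m" "c \<noteq> move_start m2"
      using e2(4) d c is_move_effect(4)[OF m] \<open>move_end m2 = c\<close> m2' corners_inner by auto
    then show ?thesis
      using e2(8) by (auto simp: c(5) d \<open>move_end m2 = c\<close>)
  qed
  \<comment> \<open>An odd third move would again need an inner vacancy, but the only odd hole now
    empty is the corner \<open>move_start m2\<close>.\<close>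
  have m3_odds: "move_start m3 \<notin> odds"
  proof
    assume a: "move_start m3 \<in> odds"
    have m3': "move_start m3 \<in> corners" "move_end m3 \<in> inner"
      using odds_move[OF in_m3 a m3] by auto
    show False
      using move_end_vacant[OF m3] m3' m2' corners_inner start_m(1) d_odds
      by (auto simp: vacant_def U_eq)
  qed
  have "parity (move_start m3) \<noteq> parity (move_start m2)"
    using m3_odds m2_odds e2(1) e3(1) odds_iff by (metis IntD2)
  then have "vacant U (move_start m3) \<subseteq> {move_start m, d}"
    by (auto simp: vacant_def U_eq)
  \<comment> \<open>The vacancy \<open>move_start m\<close> is of the class of the center, which
    supplies the required even coordinate.\<close>
  then have "card (odds \<inter> captured m3) \<le> 2"
    using two_vacancies_caps[OF m3] start_m(2) by blast
  moreover have "starts (- odds) (mid' @ [l]) = 2"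
    using n(1) m3_odds m2_odds
    unfolding mid append_Cons starts_Cons[of _ m2] starts_Cons[of _ m3] by auto
  then have "caps odds (mid' @ [l]) \<le> 8" using caps_odds_le[OF V] by simp
  moreover have "odds \<inter> captured m2 = {}" using move_odds(2)[OF m2 m2_odds] .
  \<comment> \<open>The four contributions are at most 1, 0, 2 and 8, one short of 12.\<close>
  ultimately show False
    using caps card_Int_singleton_le[of odds c]
    unfolding ms_eq mid append_Cons caps_Cons[of _ m] caps_Cons[of _ m2] caps_Cons[of _ m3] c(1)
    by simp
qed

section \<open>The C9-complement problem\<close>

text \<open>Emptying the corners takes 8 moves of odd pegs, and filling the five other holes of
  \<open>C9\<close> takes 5 moves of pegs that are not odd; no move serves both purposes.\<close>

lemma C9_complement:
  assumes ms: "is_moves (board - C9) ms C9"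
  shows "13 \<le> length ms"
    "length ms = 13 \<Longrightarrow> m \<in> set ms \<Longrightarrow> move_start m \<in> board - C9 \<and> move_end m \<in> C9"
proof -
  \<comment> \<open>This is the plus formed by the center and its four orthogonal neighbors.\<close>
  let ?cross = "C9 - inner"
  have C9: "corners \<inter> C9 = {}" "inner \<subseteq> C9" "C9 \<subseteq> board"
  proof -
    show "corners \<inter> C9 = {}" by (auto simp: C9_def corners_def)
    show "inner \<subseteq> C9" by (auto simp: C9_def inner_def)
    show "C9 \<subseteq> board" by (auto simp: C9_def board_def)
  qed
  have "corners \<inter> (board - C9) = corners" using C9 odds_board by blast
  then have corners: "starts corners ms = 8 + ends corners ms"
    using card_corners_moves[OF ms] C9 card_corners by simp
  have "?cross \<inter> C9 = ?cross" "?cross \<inter> (board - C9) = {}" by auto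
  moreover have "finite C9" "card C9 = 9"
    by (simp_all add: C9_def card_cartesian_product)
  then have "card ?cross = 5" "finite ?cross"
    using card_Diff_subset[OF finite_inner C9(2)] card_inner by simp_all
  ultimately have ends: "5 + starts ?cross ms \<le> ends ?cross ms"
    using card_moves[OF ms, of ?cross] by simp
  \<comment> \<open>This turns the count of ends on the cross into a count of starts outside
    \<open>odds\<close>, to be added to the corner starts.\<close>
  have ends_starts: "ends (- odds) ms = starts (- odds) ms"
  proof -
    have "move_end m \<in> - odds \<longleftrightarrow> move_start m \<in> - odds" if m: "m \<in> set ms" for m
    proof -
      obtain U V where "is_move U m V" using is_moves_memE[OF ms m] .
      from move_odds(1)[OF this] show ?thesis by blast
    qed
    then have "filter (\<lambda>m. move_end m \<in> - odds) ms = filter (\<lambda>m. move_start m \<in> - odds) ms"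
      by (rule filter_cong[OF refl])
    then show ?thesis by (simp only: starts_def ends_def)
  qed
  have "?cross \<subseteq> - odds" using C9 by auto
  then have mono: "starts corners ms \<le> starts odds ms" "ends ?cross ms \<le> ends (- odds) ms"
    by (auto intro: starts_mono ends_mono)
  note len = length_starts[of ms odds]
  show "13 \<le> length ms"
    using corners ends ends_starts mono len by linarith
  assume 13: "length ms = 13" and m: "m \<in> set ms"
  \<comment> \<open>With 8 + 5 moves all inequalities are tight: odd moves run from corners to inner
    holes, all others end on the cross, and none starts there.\<close>
  have eq: "starts corners ms = starts odds ms" "ends ?cross ms = ends (- odds) ms"
    "ends corners ms = 0" "starts ?cross ms = 0"
    using 13 corners ends ends_starts mono len by linarith+
  obtain U V where mv: "is_move U m V" using is_moves_memE[OF ms m] .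
  show "move_start m \<in> board - C9 \<and> move_end m \<in> C9"
  proof (cases "move_start m \<in> odds")
    case True
    have "move_start m \<in> corners"
      using starts_all_imp[OF eq(1) _ m True] by blast
    moreover have "move_end m \<in> inner"
      using move_odds(1)[OF mv] True ends_0[OF eq(3) m] by blast
    ultimately show ?thesis using C9 odds_board by blast
  next
    case False
    have "move_end m \<in> ?cross"
      using ends_all_imp[OF eq(2) \<open>?cross \<subseteq> - odds\<close> m] move_odds(1)[OF mv] False by blast
    moreover have "move_start m \<notin> ?cross"
      using eq(4) m by (auto simp: starts_def filter_empty_conv)
    ultimately show ?thesis
      using is_move_effect(1)[OF mv] False by blast
  qed
qed

theorem theorem2:
  "(\<forall>ms. solution (board - {center}) {center} ms \<longrightarrow> 13 \<le> length ms) \<and>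
   (\<forall>s\<in>board. \<forall>t\<in>board. \<forall>ms. solution (board - {s}) {t} ms \<longrightarrow> 12 \<le> length ms) \<and>
   (\<forall>ms. solution (board - C9) C9 ms \<longrightarrow>
      13 \<le> length ms \<and>
      (length ms = 13 \<longrightarrow> (\<forall>m\<in>set ms. move_start m \<in> board - C9 \<and> move_end m \<in> C9)))"
  using central_game_bound single_vacancy_bound C9_complement solution_is_moves by blast

end
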